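(* Let $G:\mathbb{R}^n\to\mathbb{R}^n$ be $L$-Lipschitz continuous and let $G_k:\mathbb{R}^n\to\mathbb{R}^n$ be approximations of $G$. Let $j\ge 0$, let $\mathbf{x}^j=\widehat{\mathbf{x}}^j\in\mathbb{R}^n$ be a common starting point, and for $k\ge j$ let $\mathbf{x}^{k+1}=G(\mathbf{x}^k)$ (exact iterates) and $\widehat{\mathbf{x}}^{k+1}=G_k(\widehat{\mathbf{x}}^k)$ (inexact iterates). Suppose that for every $k\ge j$, $$\|G(\widehat{\mathbf{x}}^k)-G_k(\widehat{\mathbf{x}}^k)\|\le\delta^k$$ for some $\delta^k>0$ (depending on $\widehat{\mathbf{x}}^k$). Then for every $k\ge j$, $$\|\widehat{\mathbf{x}}^{k+1}-\mathbf{x}^{k+1}\|\le \eta^{k+1}:=\sum_{i=0}^{k-j}L^i\,\delta^{k-i}.$$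
   Context: $\|\cdot\|$ is a norm on $\mathbb{R}^n$. $G$ is $L$-Lipschitz continuous ($L>0$) if $\|G(\mathbf{x})-G(\mathbf{z})\|\le L\|\mathbf{x}-\mathbf{z}\|$ for all $\mathbf{x},\mathbf{z}\in\mathbb{R}^n$. The superscript in $\delta^{k}$, $\eta^k$, $\mathbf{x}^k$ is an iteration index, whereas $L^i$ is the $i$-th power of $L$. *)

theory Defs
  imports "HOL-Analysis.Analysis"
begin

(* The norm on R^n is arbitrary, not necessarily the Euclidean one carried by the type
   real ^ 'n, so it is an explicit function and Lipschitz continuity is taken with respect
   to it; the library's lipschitz_on is tied to the metric of the type. *)

definition is_norm :: "(real ^ 'n \<Rightarrow> real) \<Rightarrow> bool" where
  "is_norm N \<longleftrightarrow>
     (\<forall>x. 0 \<le> N x) \<and>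
     (\<forall>x. N x = 0 \<longleftrightarrow> x = 0) \<and>
     (\<forall>a x. N (a *\<^sub>R x) = \<bar>a\<bar> * N x) \<and>
     (\<forall>x y. N (x + y) \<le> N x + N y)"

definition lipschitz_wrt ::
    "(real ^ 'n \<Rightarrow> real) \<Rightarrow> real \<Rightarrow> (real ^ 'n \<Rightarrow> real ^ 'n) \<Rightarrow> bool" where
  "lipschitz_wrt N L G \<longleftrightarrow> 0 < L \<and> (\<forall>x z. N (G x - G z) \<le> L * N (x - z))"

end

theory Submission
  imports Defs
begin

text \<open>
  Between consecutive iterates the error obeys a scalar linear recursion: inserting
  \<open>G (xhat k)\<close>, the exact map at the inexact point, splits the new error into the fresh
  approximation error, at most \<open>\<delta> k\<close>, and the old error transported by \<open>G\<close>, hence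
  amplified by at most \<open>L\<close>. Since the two sequences start at the same point, unrolling
  \<open>e (k + 1) \<le> L * e k + \<delta> k\<close> from \<open>e j = 0\<close> leaves only the contributions \<open>\<delta> (k - i)\<close>,
  each amplified by the \<open>i\<close> later applications of \<open>G\<close>.
\<close>

lemma is_norm_minus_commute:
  assumes "is_norm N"
  shows "N (a - b) = N (b - a)"
proof -
  have "N ((-1) *\<^sub>R (b - a)) = \<bar>-1\<bar> * N (b - a)"
    using assms unfolding is_norm_def by blast
  then show ?thesis by simp
qed

text \<open>
  The intermediate point in the triangle inequality is \<open>G a\<close> rather than \<open>H b\<close>, so that only \<open>G\<close> has to be
  Lipschitz and the two maps are compared only at the inexact point \<open>a\<close>.
\<close>
lemma inexact_step_error:
  assumes N: "is_norm N" and G: "lipschitz_wrt N L G" and d: "N (G a - H a) \<le> d"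
  shows "N (H a - G b) \<le> L * N (a - b) + d"
proof -
  have "N (H a - G b) = N ((H a - G a) + (G a - G b))" by simp
  also have "\<dots> \<le> N (H a - G a) + N (G a - G b)"
    using N unfolding is_norm_def by blast
  also have "N (H a - G a) = N (G a - H a)"
    by (rule is_norm_minus_commute[OF N])
  also have "N (G a - H a) + N (G a - G b) \<le> d + L * N (a - b)"
    using G d unfolding lipschitz_wrt_def by (intro add_mono) blast+
  finally show ?thesis by simp
qed

text \<open>
  A discrete Gronwall inequality with zero initial value. Multiplying the bound for \<open>k\<close>
  by \<open>L\<close> shifts the summation index by one and frees the place \<open>i = 0\<close> for the new term
  \<open>\<delta> (k + 1)\<close>; monotonicity of this multiplication is what requires \<open>0 \<le> L\<close>.
\<close>
lemma linear_recursion_bound: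
  fixes e \<delta> :: "nat \<Rightarrow> real"
  assumes L: "0 \<le> L" and start: "e j = 0"
    and step: "\<And>k. k \<ge> j \<Longrightarrow> e (Suc k) \<le> L * e k + \<delta> k"
    and "k \<ge> j"
  shows "e (Suc k) \<le> (\<Sum>i=0..k-j. L ^ i * \<delta> (k - i))"
  using \<open>k \<ge> j\<close>
proof (induction k rule: dec_induct)
  case base
  then show ?case using step[of j] start by simp
next
  case (step k)
  have "e (Suc (Suc k)) \<le> L * e (Suc k) + \<delta> (Suc k)"
    using assms(3)[of "Suc k"] step.hyps by simp
  also have "\<dots> \<le> L * (\<Sum>i=0..k-j. L ^ i * \<delta> (k - i)) + \<delta> (Suc k)"
    using mult_left_mono[OF step.IH L] by simp
  also have "\<dots> = (\<Sum>i=0..Suc (k-j). L ^ i * \<delta> (Suc k - i))"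
    unfolding sum.atLeast0_atMost_Suc_shift by (simp add: sum_distrib_left mult.assoc)
  also have "Suc (k-j) = Suc k - j"
    using step.hyps by simp
  finally show ?case .
qed

theorem lemma3p1:
  fixes N :: "real ^ 'n \<Rightarrow> real"
    and L :: real
    and G :: "real ^ 'n \<Rightarrow> real ^ 'n"
    and Gk :: "nat \<Rightarrow> real ^ 'n \<Rightarrow> real ^ 'n"
    and x xhat :: "nat \<Rightarrow> real ^ 'n"
    and \<delta> :: "nat \<Rightarrow> real"
    and j :: nat
  assumes "is_norm N"
    and "lipschitz_wrt N L G"
    and "x j = xhat j"
    and "\<And>k. k \<ge> j \<Longrightarrow> x (k + 1) = G (x k)"
    and "\<And>k. k \<ge> j \<Longrightarrow> xhat (k + 1) = Gk k (xhat k)"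
    and "\<And>k. k \<ge> j \<Longrightarrow> \<delta> k > 0"
    and "\<And>k. k \<ge> j \<Longrightarrow> N (G (xhat k) - Gk k (xhat k)) \<le> \<delta> k"
  shows "\<forall>k\<ge>j. N (xhat (k + 1) - x (k + 1)) \<le> (\<Sum>i=0..k-j. L ^ i * \<delta> (k - i))"
proof (intro allI impI)
  fix k assume "k \<ge> j"
  have L: "0 \<le> L"
    using assms(2) unfolding lipschitz_wrt_def by simp
  have start: "N (xhat j - x j) = 0"
    using assms(1,3) unfolding is_norm_def by simp
  have step: "N (xhat (Suc m) - x (Suc m)) \<le> L * N (xhat m - x m) + \<delta> m" if "m \<ge> j" for m
    using inexact_step_error[where H = "Gk m", OF assms(1,2) assms(7)[OF that]]
      assms(4)[OF that] assms(5)[OF that] by simp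
  show "N (xhat (k + 1) - x (k + 1)) \<le> (\<Sum>i=0..k-j. L ^ i * \<delta> (k - i))"
    using linear_recursion_bound[where e = "\<lambda>m. N (xhat m - x m)", OF L start step \<open>k \<ge> j\<close>]
    by simp
qed

end
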